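(* Let $\Lambda_3$ be the lattice with basis $e_1,e_2,e_3$ and Gram matrix $2\begin{pmatrix}2&-1&0\\-1&2&-1\\0&-1&2\end{pmatrix}$. Every integral lattice $M$ in $\mathbb{R}\Lambda_3$ with $\Lambda_3\subseteq M$ is isometric to one of the four lattices $\Lambda_3$, $\Lambda_3(\tfrac12 e_1)$, $\Lambda_3(\tfrac12(e_1+e_3))$, $\Lambda_3(\tfrac12 e_1,\tfrac12 e_3)$.
   Context: A lattice is integral if all inner products of its vectors are integers. For a lattice $L$ and vectors $x_1,\dots,x_k$ in $\mathbb{R}L$, $L(x_1,\dots,x_k)$ denotes the lattice $\langle L,x_1,\dots,x_k\rangle$ generated by $L$ and the $x_i$. *)

theory Defs
  imports "HOL-Analysis.Analysis" "HOL-Computational_Algebra.Group_Closure"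
begin

text \<open>
  The additive subgroup \<^term>\<open>group_closure S\<close> is the set of all integer linear combinations
  of elements of \<^term>\<open>S\<close>.  A lattice need not have full rank in the ambient Euclidean space.
\<close>

definition lattice_basis :: "'a::euclidean_space set \<Rightarrow> 'a set \<Rightarrow> bool"
  where "lattice_basis B L \<longleftrightarrow> finite B \<and> independent B \<and> L = group_closure B"

definition is_lattice :: "'a::euclidean_space set \<Rightarrow> bool"
  where "is_lattice L \<longleftrightarrow> (\<exists>B. lattice_basis B L)"

definition integral_lattice :: "'a::euclidean_space set \<Rightarrow> bool"
  where "integral_lattice L \<longleftrightarrow> is_lattice L \<and> (\<forall>x\<in>L. \<forall>y\<in>L. x \<bullet> y \<in> \<int>)"

definition gram_matrix :: "('n::finite \<Rightarrow> 'a::euclidean_space) \<Rightarrow> real^'n^'n"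
  where "gram_matrix e = (\<chi> i j. e i \<bullet> e j)"

definition adjoin :: "'a::euclidean_space set \<Rightarrow> 'a set \<Rightarrow> 'a set"
  where "adjoin L X = group_closure (L \<union> X)"

definition isometric_lattices :: "'a::euclidean_space set \<Rightarrow> 'b::euclidean_space set \<Rightarrow> bool"
  where "isometric_lattices L M \<longleftrightarrow>
    (\<exists>f. bij_betw f L M \<and>
         (\<forall>x\<in>L. \<forall>y\<in>L. f (x + y) = f x + f y) \<and>
         (\<forall>x\<in>L. \<forall>y\<in>L. f x \<bullet> f y = x \<bullet> y))"

end

theory Submission
  imports Defs
begin

text \<open>
  Pairing a vector of $M$ with the $e_i$ and with itself shows that $M \subseteq \frac12 \Lambda_3$.
  If $M$ contains half of a root (one of the six vectors $e_1$, $e_2$, $e_3$, $e_1 + e_2$,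
  $e_2 + e_3$, $e_1 + e_2 + e_3$), then the Weyl group, acting by changes to a basis with the same
  Gram matrix, moves this root to $e_1$; integrality against $\frac12 e_1$ then makes the
  $e_2$-coordinate integral on all of $M$, so only $\frac12 e_3$ can still be adjoined.
  Otherwise $\frac12 (e_1 + e_3)$ is the only nonzero class of $M$ modulo $\Lambda_3$.
\<close>

section \<open>Subgroups generated by sets of vectors\<close>

lemma group_closure_minimal:
  assumes "S \<subseteq> group_closure T"
  shows "group_closure S \<subseteq> group_closure T"
proof
  fix x assume "x \<in> group_closure S"
  then show "x \<in> group_closure T"
    by induction (use assms in \<open>auto intro: group_closure.diff\<close>)
qed

lemma group_closure_scaleR_of_int:
  fixes x :: "'a::real_vector"
  assumes "x \<in> group_closure S"
  shows "of_int k *\<^sub>R x \<in> group_closure S"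
proof -
  have nat: "of_nat n *\<^sub>R x \<in> group_closure S" for n
    by (induction n) (auto simp: scaleR_add_left intro: group_closure_add assms)
  show ?thesis
  proof (cases k rule: int_cases2)
    case (nonneg n)
    then show ?thesis using nat[of n] by simp
  next
    case (nonpos n)
    then show ?thesis using nat[of n] by simp
  qed
qed

lemma group_closure_subset_span:
  fixes S :: "'a::real_vector set"
  shows "group_closure S \<subseteq> span S"
proof
  fix x assume "x \<in> group_closure S"
  then show "x \<in> span S"
    by induction (auto intro: span_base span_zero span_diff)
qed

lemma linear_image_group_closure:
  assumes "linear f"
  shows "f ` group_closure S = group_closure (f ` S)"
proof
  show "f ` group_closure S \<subseteq> group_closure (f ` S)"
  proof clarify
    fix x assume "x \<in> group_closure S"
    then show "f x \<in> group_closure (f ` S)"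
      by induction (auto simp: linear_0[OF assms] linear_diff[OF assms]
          intro: group_closure.intros)
  qed
  show "group_closure (f ` S) \<subseteq> f ` group_closure S"
  proof
    fix y assume "y \<in> group_closure (f ` S)"
    then show "y \<in> f ` group_closure S"
    proof induction
      \<comment> \<open>The base rule admits 0 as well as the generators, so 0 needs a preimage
        too.\<close>
      case (base s)
      then show ?case
        using linear_0[OF assms]
        by (auto intro: group_closure.base rev_image_eqI[of 0])
    next
      case (diff s t)
      then show ?case
        by (auto simp: linear_diff[OF assms, symmetric] intro: group_closure.diff)
    qed
  qed
qed

section \<open>Isometries of lattices and Gram matrices\<close>

text \<open>The inverse bijection works. For its additivity, the sum of two preimages has to lie in
  \<open>L\<close> again, which is where \<open>L = group_closure S\<close> enters.\<close>

lemma isometric_lattices_sym: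
  assumes iso: "isometric_lattices L N" and L: "L = group_closure S"
  shows "isometric_lattices N L"
proof -
  from iso obtain f where f: "bij_betw f L N"
    and add: "\<And>x y. x \<in> L \<Longrightarrow> y \<in> L \<Longrightarrow> f (x + y) = f x + f y"
    and inner: "\<And>x y. x \<in> L \<Longrightarrow> y \<in> L \<Longrightarrow> f x \<bullet> f y = x \<bullet> y"
    unfolding isometric_lattices_def by blast
  define g where "g = inv_into L f"
  have gf: "g (f x) = x" if "x \<in> L" for x
    using f that by (simp add: g_def bij_betw_inv_into_left)
  have N: "N = f ` L" using f by (simp add: bij_betw_def)
  have plus: "x + y \<in> L" if "x \<in> L" "y \<in> L" for x y
    using that group_closure_add unfolding L by blast
  show ?thesis
    unfolding isometric_lattices_def
  proof (intro exI[of _ g] conjI ballI)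
    show "bij_betw g N L" using f by (simp add: g_def bij_betw_inv_into)
    show "g (x + y) = g x + g y" if "x \<in> N" "y \<in> N" for x y
      using that plus unfolding N by (auto simp: gf add[symmetric])
    show "g x \<bullet> g y = x \<bullet> y" if "x \<in> N" "y \<in> N" for x y
      using that unfolding N by (auto simp: gf inner)
  qed
qed

lemma isometric_lattices_refl: "isometric_lattices L L"
  unfolding isometric_lattices_def by (intro exI[of _ id]) auto

text \<open>Injectivity comes from positive definiteness: if \<open>f x = f y\<close>, then
  \<open>x - y\<close> has the same norm as its image 0.\<close>

lemma isometric_lattices_linear_image:
  assumes f: "linear f"
    and inner: "\<And>x y. x \<in> span S \<Longrightarrow> y \<in> span S \<Longrightarrow> f x \<bullet> f y = x \<bullet> y"
  shows "isometric_lattices (group_closure S) (group_closure (f ` S))"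
proof -
  have sub: "x \<in> span S" if "x \<in> group_closure S" for x
    using that group_closure_subset_span by blast
  have "inj_on f (group_closure S)"
  proof (rule inj_onI)
    fix x y assume x: "x \<in> group_closure S" and y: "y \<in> group_closure S" and eq: "f x = f y"
    have "x - y \<in> span S" using sub x y by (simp add: span_diff)
    then have "(x - y) \<bullet> (x - y) = f (x - y) \<bullet> f (x - y)" by (simp add: inner)
    also have "\<dots> = 0" using eq by (simp add: linear_diff[OF f])
    finally show "x = y" by simp
  qed
  then have "bij_betw f (group_closure S) (group_closure (f ` S))"
    by (simp add: bij_betw_def linear_image_group_closure[OF f])
  then show ?thesis
    unfolding isometric_lattices_def
    by (intro exI[of _ f]) (auto simp: linear_add[OF f] inner sub)
qed

text \<open>The linear extension of \<open>e i\<close> to \<open>e' i\<close> preserves inner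
  products by bilinearity. Independence of \<open>range e\<close> does not exclude repetitions in
  \<open>e\<close>; the \<open>wd\<close> step shows that \<open>e'\<close> then repeats as well, so
  the assignment is well defined.\<close>

lemma gram_matrix_eq_imp_linear_isometry:
  fixes e :: "'n::finite \<Rightarrow> 'a::euclidean_space" and e' :: "'n \<Rightarrow> 'b::euclidean_space"
  assumes gram: "gram_matrix e = gram_matrix e'"
    and indep: "independent (range e)"
  obtains f where "linear f" "\<And>i. f (e i) = e' i"
    "\<And>x y. x \<in> span (range e) \<Longrightarrow> y \<in> span (range e) \<Longrightarrow> f x \<bullet> f y = x \<bullet> y"
proof -
  have g: "e i \<bullet> e j = e' i \<bullet> e' j" for i j
    using gram by (simp add: gram_matrix_def vec_eq_iff)
  have wd: "e' i = e' j" if "e i = e j" for i j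
  proof -
    have "(e' i - e' j) \<bullet> (e' i - e' j) = (e i - e j) \<bullet> (e i - e j)"
      by (simp add: inner_diff g)
    then show ?thesis using that by simp
  qed
  obtain f where f: "linear f" "\<forall>x\<in>range e. f x = e' (inv e x)"
    using linear_independent_extend[OF indep, of "\<lambda>x. e' (inv e x)"] by auto
  have fe: "f (e i) = e' i" for i
  proof -
    have "f (e i) = e' (inv e (e i))" using f(2) by blast
    also have "\<dots> = e' i" by (rule wd) (simp add: f_inv_into_f)
    finally show ?thesis .
  qed
  \<comment> \<open>Bilinearity is used one argument at a time: first against the generators, then
    against their span.\<close>
  have 1: "f x \<bullet> e' i = x \<bullet> e i" if "x \<in> span (range e)" for x i
    using that
    by (induction rule: span_induct_alt)
      (auto simp: linear_0[OF f(1)] linear_add[OF f(1)] linear_scale[OF f(1)] inner_add_left fe g)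
  have "f x \<bullet> f y = x \<bullet> y" if "x \<in> span (range e)" "y \<in> span (range e)" for x y
    using that(2)
    by (induction rule: span_induct_alt)
      (auto simp: linear_0[OF f(1)] linear_add[OF f(1)] linear_scale[OF f(1)] inner_add_right fe
        1[OF that(1)])
  with f(1) fe show thesis by (rule that)
qed

text \<open>This is twice the Cartan matrix of type A3. As a relation on three vectors it applies to
  every basis obtained from the given one by the Weyl group.\<close>

definition a3_gram :: "'a::euclidean_space \<Rightarrow> 'a \<Rightarrow> 'a \<Rightarrow> bool"
  where "a3_gram a b c \<longleftrightarrow> a \<bullet> a = 4 \<and> b \<bullet> b = 4 \<and> c \<bullet> c = 4 \<and>
    a \<bullet> b = -2 \<and> b \<bullet> c = -2 \<and> a \<bullet> c = 0"

lemma a3_gram_imp_linear_isometry: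
  fixes a b c :: "'a::euclidean_space" and a' b' c' :: "'b::euclidean_space"
  assumes "a3_gram a b c" "a3_gram a' b' c'" "independent {a, b, c}"
  obtains f where "linear f" "f a = a'" "f b = b'" "f c = c'"
    "\<And>x y. x \<in> span {a, b, c} \<Longrightarrow> y \<in> span {a, b, c} \<Longrightarrow> f x \<bullet> f y = x \<bullet> y"
proof -
  define e :: "3 \<Rightarrow> 'a" where "e = (\<lambda>i. if i = 1 then a else if i = 2 then b else c)"
  define e' :: "3 \<Rightarrow> 'b" where "e' = (\<lambda>i. if i = 1 then a' else if i = 2 then b' else c')"
  have gram: "gram_matrix e = gram_matrix e'"
    using assms(1,2)
    by (simp add: gram_matrix_def vec_eq_iff forall_3 e_def e'_def a3_gram_def inner_commute)
  have e: "e 1 = a" "e 2 = b" "e 3 = c" and e': "e' 1 = a'" "e' 2 = b'" "e' 3 = c'"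
    by (simp_all add: e_def e'_def)
  have r: "range e = {a, b, c}"
    by (simp add: UNIV_3 e)
  obtain f where f: "linear f" "\<And>i. f (e i) = e' i"
    "\<And>x y. x \<in> span (range e) \<Longrightarrow> y \<in> span (range e) \<Longrightarrow> f x \<bullet> f y = x \<bullet> y"
    using gram_matrix_eq_imp_linear_isometry[OF gram assms(3)[folded r]] by blast
  have abc: "f a = a'" "f b = b'" "f c = c'"
    using f(2)[of 1] f(2)[of 2] f(2)[of 3] by (simp_all only: e e')
  show thesis by (rule that[OF f(1) abc f(3)[unfolded r]])
qed

section \<open>Integrality forces half-integral coordinates\<close>

text \<open>
  With \<^term>\<open>i\<close>, \<^term>\<open>j\<close>, \<^term>\<open>k\<close> the pairings of a vector with the basis, its coordinates are
  \<open>(2i + m)/8\<close>, \<open>m/4\<close>, \<open>(2k + m)/8\<close> where \<open>m = i + 2j + k\<close>, and its norm is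
  \<open>(2i\<^sup>2 + 2k\<^sup>2 + m\<^sup>2)/8\<close>.
\<close>

lemma norm_integral_imp_coordinates_half_integral:
  fixes i k m n :: int
  assumes "8 * n = 2 * i\<^sup>2 + 2 * k\<^sup>2 + m\<^sup>2" "even (m - i - k)"
  shows "4 dvd 2 * i + m" "even m" "4 dvd 2 * k + m"
proof -
  have "even (m\<^sup>2)" using arg_cong[OF assms(1), of even] by simp
  then show "even m" by simp
  then obtain t where t: "m = 2 * t" by blast
  have eq: "4 * n = i\<^sup>2 + k\<^sup>2 + 2 * t\<^sup>2" using assms(1) by (simp add: t power2_eq_square)
  have par: "even i \<longleftrightarrow> even k" using assms(2) t by simp
  \<comment> \<open>Modulo 4: for even \<open>i\<close> and \<open>k\<close> the squares contribute
    0, so \<open>2 * t^2\<close> is divisible by 4; for odd ones they contribute 2, so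
    \<open>t^2\<close> is odd.\<close>
  have "even i \<longleftrightarrow> even t"
  proof (cases "even i")
    case True
    then obtain u v where "i = 2 * u" "k = 2 * v" using par by blast
    with eq have "t\<^sup>2 = 2 * (n - u\<^sup>2 - v\<^sup>2)" by (simp add: power2_eq_square algebra_simps)
    then have "even (t\<^sup>2)" by simp
    then show ?thesis using True by simp
  next
    case False
    then obtain u v where "i = 2 * u + 1" "k = 2 * v + 1" using par by (metis oddE)
    with eq have "t\<^sup>2 = 2 * (n - u\<^sup>2 - v\<^sup>2 - u - v - 1) + 1"
      by (simp add: power2_eq_square algebra_simps)
    then have "odd (t\<^sup>2)" by simp
    then show ?thesis using False by simp
  qed
  then have "even (i + t)" "even (k + t)" using par by simp_all
  then show "4 dvd 2 * i + m" "4 dvd 2 * k + m"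
    unfolding t by presburger+
qed

text \<open>Integral pairings with the basis only bound the denominators by 8, 4 and 8. The integral
  norm \<open>x \<bullet> x\<close> reduces them all to 2.\<close>

lemma half_integral_coordinates:
  fixes a b c x :: "'a::euclidean_space"
  assumes G: "a3_gram a b c" and x: "x \<in> span {a, b, c}"
    and int: "x \<bullet> a \<in> \<int>" "x \<bullet> b \<in> \<int>" "x \<bullet> c \<in> \<int>" "x \<bullet> x \<in> \<int>"
  obtains p q r :: int
  where "x = (1/2) *\<^sub>R (of_int p *\<^sub>R a + of_int q *\<^sub>R b + of_int r *\<^sub>R c)"
proof -
  obtain u v w where xe: "x = u *\<^sub>R a + v *\<^sub>R b + w *\<^sub>R c"
    using x by (auto simp: span_breakdown_eq algebra_simps)
  obtain i j k n :: int where ijkn: "x \<bullet> a = i" "x \<bullet> b = j" "x \<bullet> c = k" "x \<bullet> x = n"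
    using int by (auto elim!: Ints_cases)
  have i: "4 * u - 2 * v = i" and j: "4 * v - 2 * u - 2 * w = j" and k: "4 * w - 2 * v = k"
    using G ijkn(1-3) by (simp_all add: xe a3_gram_def inner_add inner_commute)
  define m where "m = i + 2 * j + k"
  have m: "4 * v = m" using i j k by (simp add: m_def)
  have u: "8 * u = of_int (2 * i + m)" and w: "8 * w = of_int (2 * k + m)"
    using i k m by simp_all
  \<comment> \<open>Expanding only one factor keeps the pairings \<open>i\<close>, \<open>j\<close>,
    \<open>k\<close>; multiplying by 8 then clears the denominators of \<open>u\<close>,
    \<open>v\<close>, \<open>w\<close>.\<close>
  have "real_of_int n = x \<bullet> (u *\<^sub>R a + v *\<^sub>R b + w *\<^sub>R c)" using ijkn(4) xe by simp
  also have "\<dots> = u * i + v * j + w * k" by (simp add: inner_add ijkn)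
  finally have "8 * real_of_int n = (8 * u) * i + 2 * (4 * v) * j + (8 * w) * k" by simp
  also have "\<dots> = of_int (2 * i\<^sup>2 + 2 * k\<^sup>2 + m\<^sup>2)"
    unfolding u m w by (simp add: m_def power2_eq_square algebra_simps)
  finally have "8 * n = 2 * i\<^sup>2 + 2 * k\<^sup>2 + m\<^sup>2"
    by (metis of_int_eq_iff of_int_mult of_int_numeral)
  moreover have "even (m - i - k)" by (simp add: m_def)
  ultimately have "4 dvd 2 * i + m" "even m" "4 dvd 2 * k + m"
    by (rule norm_integral_imp_coordinates_half_integral)+
  then obtain p q r where "2 * i + m = 4 * p" "m = 2 * q" "2 * k + m = 4 * r"
    by (metis dvdE)
  then have "u = p / 2" "v = q / 2" "w = r / 2" using u m w by simp_all
  then have "x = (1/2) *\<^sub>R (of_int p *\<^sub>R a + of_int q *\<^sub>R b + of_int r *\<^sub>R c)"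
    by (simp only: xe) (simp add: algebra_simps)
  then show thesis by (rule that)
qed

section \<open>Overlattices containing half a root\<close>

text \<open>Pairing with half of \<open>a\<close> makes the coordinate at \<open>b\<close> integral.
  So \<open>M\<close> lies between the lattices generated by \<open>a/2, b, c\<close> and by
  \<open>a/2, b, c/2\<close>. The first has index two in the second, so \<open>M\<close> is one of
  them.\<close>

lemma half_first_root_overlattice:
  fixes a b c :: "'a::euclidean_space"
  assumes G: "a3_gram a b c" and M: "M = group_closure B"
    and sub: "{a, b, c} \<subseteq> M" "M \<subseteq> span {a, b, c}"
    and int: "\<And>x y. x \<in> M \<Longrightarrow> y \<in> M \<Longrightarrow> x \<bullet> y \<in> \<int>"
    and half: "(1/2) *\<^sub>R a \<in> M"
  shows "M = group_closure {a, b, c, (1/2) *\<^sub>R a} \<or>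
         M = group_closure {a, b, c, (1/2) *\<^sub>R a, (1/2) *\<^sub>R c}"
proof -
  have coords: "\<exists>p q r :: int. x = of_int p *\<^sub>R ((1/2) *\<^sub>R a) + of_int q *\<^sub>R b + of_int r *\<^sub>R ((1/2) *\<^sub>R c)"
    if x: "x \<in> M" for x
  proof -
    have "x \<in> span {a, b, c}" "x \<bullet> a \<in> \<int>" "x \<bullet> b \<in> \<int>" "x \<bullet> c \<in> \<int>" "x \<bullet> x \<in> \<int>"
      using x sub int by auto
    then obtain p q r :: int
      where pqr: "x = (1/2) *\<^sub>R (of_int p *\<^sub>R a + of_int q *\<^sub>R b + of_int r *\<^sub>R c)"
      using half_integral_coordinates[OF G] by metis
    have "x \<bullet> ((1/2) *\<^sub>R a) \<in> \<int>" using int[OF x half] .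
    moreover have "x \<bullet> ((1/2) *\<^sub>R a) = of_int p - of_int q / 2"
      using G by (simp add: pqr a3_gram_def inner_add inner_commute)
    ultimately obtain z :: int where "real_of_int p - of_int q / 2 = of_int z"
      by (metis Ints_cases)
    then have "real_of_int q = of_int (2 * (p - z))" by simp
    then have q: "q = 2 * (p - z)" by (simp only: of_int_eq_iff)
    have "x = of_int p *\<^sub>R ((1/2) *\<^sub>R a) + of_int (p - z) *\<^sub>R b + of_int r *\<^sub>R ((1/2) *\<^sub>R c)"
      unfolding pqr q by (simp add: algebra_simps)
    then show ?thesis by blast
  qed
  have upper: "group_closure S \<subseteq> M" if "S \<subseteq> M" for S
    using that group_closure_minimal unfolding M by blast
  show ?thesis
  proof (cases "(1/2) *\<^sub>R c \<in> M")
    case True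
    have "M = group_closure {a, b, c, (1/2) *\<^sub>R a, (1/2) *\<^sub>R c}" (is "_ = ?N")
    proof
      show "?N \<subseteq> M" using sub half True by (intro upper) auto
      show "M \<subseteq> ?N"
      proof
        fix x assume "x \<in> M"
        then obtain p q r :: int where
          x: "x = of_int p *\<^sub>R ((1/2) *\<^sub>R a) + of_int q *\<^sub>R b + of_int r *\<^sub>R ((1/2) *\<^sub>R c)"
          using coords by blast
        show "x \<in> ?N"
          unfolding x by (intro group_closure_add group_closure_scaleR_of_int group_closure.base) auto
      qed
    qed
    then show ?thesis ..
  next
    case False
    have "M = group_closure {a, b, c, (1/2) *\<^sub>R a}" (is "_ = ?N")
    proof
      show "?N \<subseteq> M" using sub half by (intro upper) auto
      show "M \<subseteq> ?N"
      proof
        fix x assume xM: "x \<in> M"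
        then obtain p q r :: int where
          x: "x = of_int p *\<^sub>R ((1/2) *\<^sub>R a) + of_int q *\<^sub>R b + of_int r *\<^sub>R ((1/2) *\<^sub>R c)"
          using coords by blast
        have "even r"
        proof (rule ccontr)
          \<comment> \<open>Removing the part of \<open>x\<close> already known to lie in
            \<open>M\<close> would leave exactly half of \<open>c\<close>.\<close>
          assume "odd r"
          then obtain s where s: "r = 2 * s + 1" by (rule oddE)
          have "of_int p *\<^sub>R ((1/2) *\<^sub>R a) + of_int q *\<^sub>R b + of_int s *\<^sub>R c \<in> M"
            using sub half unfolding M
            by (intro group_closure_add group_closure_scaleR_of_int) auto
          then have "x - (of_int p *\<^sub>R ((1/2) *\<^sub>R a) + of_int q *\<^sub>R b + of_int s *\<^sub>R c) \<in> M"
            using xM unfolding M by (intro group_closure.diff)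
          also have "x - (of_int p *\<^sub>R ((1/2) *\<^sub>R a) + of_int q *\<^sub>R b + of_int s *\<^sub>R c) = (1/2) *\<^sub>R c"
            by (simp add: x s algebra_simps)
          finally show False using False by simp
        qed
        then obtain s where "r = 2 * s" by blast
        then have x': "x = of_int p *\<^sub>R ((1/2) *\<^sub>R a) + of_int q *\<^sub>R b + of_int s *\<^sub>R c"
          by (simp add: x)
        show "x \<in> ?N"
          unfolding x' by (intro group_closure_add group_closure_scaleR_of_int group_closure.base) auto
      qed
    qed
    then show ?thesis ..
  qed
qed

text \<open>The previous lemma describes \<open>M\<close> through \<open>a', b', c'\<close>; the
  isometry matching the two bases carries this description to the reference basis
  \<open>a, b, c\<close>.\<close>

lemma half_first_root_isometric:
  fixes a b c :: "'a::euclidean_space" and a' b' c' :: "'b::euclidean_space"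
  assumes G: "a3_gram a b c" "independent {a, b, c}"
    and G': "a3_gram a' b' c'" and M: "M = group_closure B"
    and sub: "{a', b', c'} \<subseteq> M" "M \<subseteq> span {a', b', c'}"
    and int: "\<And>x y. x \<in> M \<Longrightarrow> y \<in> M \<Longrightarrow> x \<bullet> y \<in> \<int>"
    and half: "(1/2) *\<^sub>R a' \<in> M"
  shows "isometric_lattices M (group_closure {a, b, c, (1/2) *\<^sub>R a}) \<or>
         isometric_lattices M (group_closure {a, b, c, (1/2) *\<^sub>R a, (1/2) *\<^sub>R c})"
proof -
  obtain f where f: "linear f" "f a = a'" "f b = b'" "f c = c'"
    and inner: "\<And>x y. x \<in> span {a, b, c} \<Longrightarrow> y \<in> span {a, b, c} \<Longrightarrow> f x \<bullet> f y = x \<bullet> y"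
    using a3_gram_imp_linear_isometry[OF G(1) G' G(2)] by metis
  \<comment> \<open>\<open>f\<close> starts at the reference basis, whose independence is assumed,
    so symmetry is needed to obtain an isometry out of \<open>M\<close>.\<close>
  have iso: "isometric_lattices (group_closure (f ` S)) (group_closure S)"
    if "S \<subseteq> span {a, b, c}" for S
  proof (rule isometric_lattices_sym[OF isometric_lattices_linear_image[OF f(1)] refl])
    have "span S \<subseteq> span {a, b, c}"
      using that by (intro span_minimal) auto
    then show "f x \<bullet> f y = x \<bullet> y" if "x \<in> span S" "y \<in> span S" for x y
      using that by (intro inner) auto
  qed
  have "isometric_lattices (group_closure {a', b', c', (1/2) *\<^sub>R a'}) (group_closure {a, b, c, (1/2) *\<^sub>R a})"
    using iso[of "{a, b, c, (1/2) *\<^sub>R a}"]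
    by (simp add: f linear_scale[OF f(1)] span_base span_scale)
  moreover have "isometric_lattices (group_closure {a', b', c', (1/2) *\<^sub>R a', (1/2) *\<^sub>R c'})
      (group_closure {a, b, c, (1/2) *\<^sub>R a, (1/2) *\<^sub>R c})"
    using iso[of "{a, b, c, (1/2) *\<^sub>R a, (1/2) *\<^sub>R c}"]
    by (simp add: f linear_scale[OF f(1)] span_base span_scale)
  ultimately show ?thesis
    using half_first_root_overlattice[OF G' M sub int half] by auto
qed

text \<open>
  Up to sign, the six bases below are $x_{\sigma 1} - x_{\sigma 2}, x_{\sigma 2} - x_{\sigma 3},
  x_{\sigma 3} - x_{\sigma 4}$ for permutations $\sigma$ of the coordinates of the standard model
  $e_i = x_i - x_{i+1}$.
\<close>

lemma half_root_isometric:
  fixes a b c :: "'a::euclidean_space"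
  assumes G: "a3_gram a b c" "independent {a, b, c}" and M: "M = group_closure B"
    and sub: "{a, b, c} \<subseteq> M" "M \<subseteq> span {a, b, c}"
    and int: "\<And>x y. x \<in> M \<Longrightarrow> y \<in> M \<Longrightarrow> x \<bullet> y \<in> \<int>"
    and v: "(1/2) *\<^sub>R v \<in> M" "v \<in> {a, b, c, a + b, b + c, a + b + c}"
  shows "isometric_lattices M (group_closure {a, b, c, (1/2) *\<^sub>R a}) \<or>
         isometric_lattices M (group_closure {a, b, c, (1/2) *\<^sub>R a, (1/2) *\<^sub>R c})"
proof -
  \<comment> \<open>It suffices to extend \<open>v\<close> inside \<open>M\<close> to a triple with
    the same Gram matrix and the same real span.\<close>
  have *: ?thesis
    if "a3_gram v b' c'" "v \<in> M" "b' \<in> M" "c' \<in> M"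
      "a \<in> span {v, b', c'}" "b \<in> span {v, b', c'}" "c \<in> span {v, b', c'}" for b' c'
  proof -
    have M': "{v, b', c'} \<subseteq> M" using that by simp
    have "span {a, b, c} \<subseteq> span {v, b', c'}"
      using that(5-7) by (intro span_minimal) auto
    then have span: "M \<subseteq> span {v, b', c'}" using sub by blast
    show ?thesis by (rule half_first_root_isometric[OF G that(1) M M' span int v(1)])
  qed
  have abc: "a \<in> M" "b \<in> M" "c \<in> M" using sub by auto
  have closed: "x + y \<in> M" "x - y \<in> M" "- x \<in> M" if "x \<in> M" "y \<in> M" for x y
    using that unfolding M by (auto intro: group_closure_add group_closure.diff)
  \<comment> \<open>The listed combinations are those that recover \<open>a\<close>,
    \<open>b\<close>, \<open>c\<close> from the six new bases.\<close>
  have in_span: "w \<in> span {x, y, z}"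
    if "w \<in> {x, y, z, - y, x + y, y + z, - x - y, - y - z, x + y + z}" for w x y z :: 'a
  proof -
    have "x \<in> span {x, y, z}" "y \<in> span {x, y, z}" "z \<in> span {x, y, z}"
      by (auto intro: span_base)
    then show ?thesis using that by (auto intro: span_add span_diff span_neg)
  qed
  have g: "a \<bullet> a = 4" "b \<bullet> b = 4" "c \<bullet> c = 4" "a \<bullet> b = -2" "b \<bullet> a = -2" "b \<bullet> c = -2" "c \<bullet> b = -2"
    "a \<bullet> c = 0" "c \<bullet> a = 0"
    using G(1) by (simp_all add: a3_gram_def inner_commute)
  note gram = a3_gram_def inner_add inner_diff g
  consider "v = a" | "v = b" | "v = c" | "v = a + b" | "v = b + c" | "v = a + b + c"
    using v(2) by blast
  then show ?thesis
  proof cases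
    case 1
    show ?thesis
    proof (rule *[of "b" "c"], unfold 1)
      show "a3_gram (a) (b) (c)" by (simp add: gram)
      show "a \<in> M" "b \<in> M" "c \<in> M" using abc by (simp_all add: closed)
    qed (rule in_span, simp)+
  next
    case 2
    show ?thesis
    \<comment> \<open>Here \<open>b\<close> is \<open>x2 - x3\<close>, completed to the chain
      \<open>x2 - x3, x3 - x1, x1 - x4\<close>. The other cases likewise start a chain, up to sign,
      with the two indices of \<open>v\<close>.\<close>
    proof (rule *[of "- a - b" "a + b + c"], unfold 2)
      show "a3_gram (b) (- a - b) (a + b + c)" by (simp add: gram)
      show "b \<in> M" "- a - b \<in> M" "a + b + c \<in> M" using abc by (simp_all add: closed)
    qed (rule in_span, simp)+
  next
    case 3
    show ?thesis
    proof (rule *[of "b" "a"], unfold 3)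
      show "a3_gram (c) (b) (a)" by (simp add: gram)
      show "c \<in> M" "b \<in> M" "a \<in> M" using abc by (simp_all add: closed)
    qed (rule in_span, simp)+
  next
    case 4
    show ?thesis
    proof (rule *[of "- b" "b + c"], unfold 4)
      show "a3_gram (a + b) (- b) (b + c)" by (simp add: gram)
      show "a + b \<in> M" "- b \<in> M" "b + c \<in> M" using abc by (simp_all add: closed)
    qed (rule in_span, simp)+
  next
    case 5
    show ?thesis
    proof (rule *[of "- a - b - c" "a + b"], unfold 5)
      show "a3_gram (b + c) (- a - b - c) (a + b)" by (simp add: gram)
      show "b + c \<in> M" "- a - b - c \<in> M" "a + b \<in> M" using abc by (simp_all add: closed)
    qed (rule in_span, simp)+
  next
    case 6
    show ?thesis
    proof (rule *[of "- b - c" "b"], unfold 6)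
      show "a3_gram (a + b + c) (- b - c) (b)" by (simp add: gram)
      show "a + b + c \<in> M" "- b - c \<in> M" "b \<in> M" using abc by (simp_all add: closed)
    qed (rule in_span, simp)+
  qed
qed

section \<open>Overlattices containing no half root\<close>

text \<open>Of the seven nonzero classes of half the lattice modulo the lattice, six are represented
  by half roots and are excluded. Only the class of half of \<open>a + c\<close> remains, since
  \<open>a + c\<close> is a sum of two orthogonal roots and not a root.\<close>

lemma no_half_root_overlattice:
  fixes a b c :: "'a::euclidean_space"
  assumes G: "a3_gram a b c" and M: "M = group_closure B"
    and sub: "{a, b, c} \<subseteq> M" "M \<subseteq> span {a, b, c}"
    and int: "\<And>x y. x \<in> M \<Longrightarrow> y \<in> M \<Longrightarrow> x \<bullet> y \<in> \<int>"
    and no_half: "\<And>v. v \<in> {a, b, c, a + b, b + c, a + b + c} \<Longrightarrow> (1/2) *\<^sub>R v \<notin> M"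
  shows "M = group_closure {a, b, c} \<or> M = group_closure {a, b, c, (1/2) *\<^sub>R (a + c)}"
proof -
  define L where "L = group_closure {a, b, c}"
  \<comment> \<open>The eight classes of half of \<open>L\<close> modulo \<open>L\<close>, indexed
    by the parities of the doubled coordinates.\<close>
  define h :: "bool \<Rightarrow> bool \<Rightarrow> bool \<Rightarrow> 'a"
    where "h p q r = (1/2) *\<^sub>R (of_bool p *\<^sub>R a + of_bool q *\<^sub>R b + of_bool r *\<^sub>R c)" for p q r
  have L: "of_int p *\<^sub>R a + of_int q *\<^sub>R b + of_int r *\<^sub>R c \<in> L" for p q r
    unfolding L_def by (intro group_closure_add group_closure_scaleR_of_int group_closure.base) auto
  have upper: "group_closure S \<subseteq> M" if "S \<subseteq> M" for S
    using that group_closure_minimal unfolding M by blast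
  then have LM: "L \<subseteq> M"
    using sub(1) unfolding L_def by blast
  \<comment> \<open>Splitting each doubled coordinate into quotient and remainder modulo 2 separates
    a vector of \<open>L\<close> from a representative \<open>h\<close>, which stays in
    \<open>M\<close> because \<open>L\<close> does.\<close>
  have red: "\<exists>p q r. h p q r \<in> M \<and> x - h p q r \<in> L" if x: "x \<in> M" for x
  proof -
    have "x \<in> span {a, b, c}" "x \<bullet> a \<in> \<int>" "x \<bullet> b \<in> \<int>" "x \<bullet> c \<in> \<int>" "x \<bullet> x \<in> \<int>"
      using x sub int by auto
    then obtain p q r :: int
      where pqr: "x = (1/2) *\<^sub>R (of_int p *\<^sub>R a + of_int q *\<^sub>R b + of_int r *\<^sub>R c)"
      using half_integral_coordinates[OF G] by metis
    have par: "real_of_int z = 2 * of_int (z div 2) + of_bool (odd z)" for z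
    proof -
      have "z = 2 * (z div 2) + of_bool (odd z)" by (simp add: of_bool_odd_eq_mod_2)
      then show ?thesis by (metis of_int_add of_int_mult of_int_numeral of_int_of_bool)
    qed
    let ?l = "of_int (p div 2) *\<^sub>R a + of_int (q div 2) *\<^sub>R b + of_int (r div 2) *\<^sub>R c"
    have l: "x - h (odd p) (odd q) (odd r) = ?l"
      unfolding pqr h_def par[of p] par[of q] par[of r]
      by (simp only: scaleR_add_left scaleR_add_right) (simp add: scaleR_add_left)
    have "?l \<in> M" using L LM by blast
    then have "x - ?l \<in> M" using x unfolding M by (intro group_closure.diff)
    moreover have "x - ?l = h (odd p) (odd q) (odd r)" unfolding l[symmetric] by simp
    moreover have "x - h (odd p) (odd q) (odd r) \<in> L" unfolding l by (rule L)
    ultimately show ?thesis by metis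
  qed
  \<comment> \<open>The two surviving parity patterns are those of 0 and of half of
    \<open>a + c\<close>.\<close>
  have h: "\<not> q \<and> p = r" if "h p q r \<in> M" for p q r
    using that no_half by (cases p; cases q; cases r) (auto simp: h_def)
  show ?thesis
  proof (cases "(1/2) *\<^sub>R (a + c) \<in> M")
    case True
    have "M = group_closure {a, b, c, (1/2) *\<^sub>R (a + c)}" (is "_ = ?N")
    proof
      show "?N \<subseteq> M" using sub True by (intro upper) auto
      show "M \<subseteq> ?N"
      proof
        fix x assume "x \<in> M"
        then obtain p q r where *: "h p q r \<in> M" "x - h p q r \<in> L" using red by blast
        have "h p q r \<in> ?N"
          using h[OF *(1)] by (cases r) (auto simp: h_def intro: group_closure.base)
        moreover have "L \<subseteq> ?N"
          unfolding L_def by (intro group_closure_minimal) (auto intro: group_closure.base)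
        ultimately have "(x - h p q r) + h p q r \<in> ?N" using *(2) by (blast intro: group_closure_add)
        then show "x \<in> ?N" by simp
      qed
    qed
    then show ?thesis ..
  next
    case False
    have "M \<subseteq> L"
    proof
      fix x assume "x \<in> M"
      then obtain p q r where *: "h p q r \<in> M" "x - h p q r \<in> L" using red by blast
      have "h p q r = 0"
        using h[OF *(1)] *(1) False by (cases r) (auto simp: h_def)
      then show "x \<in> L" using *(2) by simp
    qed
    then show ?thesis using LM unfolding L_def by blast
  qed
qed

section \<open>Classification of the integral overlattices\<close>

lemma adjoin_group_closure: "adjoin (group_closure S) X = group_closure (S \<union> X)"
proof
  show "adjoin (group_closure S) X \<subseteq> group_closure (S \<union> X)"
    unfolding adjoin_def
  proof (rule group_closure_minimal, rule Un_least)
    show "group_closure S \<subseteq> group_closure (S \<union> X)"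
      by (intro group_closure_minimal) (auto intro: group_closure.base)
  qed (auto intro: group_closure.base)
  show "group_closure (S \<union> X) \<subseteq> adjoin (group_closure S) X"
    unfolding adjoin_def by (intro group_closure_minimal) (auto intro: group_closure.base)
qed

theorem theorem4p1:
  fixes e :: "3 \<Rightarrow> 'a::euclidean_space" and \<Lambda>\<^sub>3 M :: "'a set"
  assumes basis: "lattice_basis (range e) \<Lambda>\<^sub>3"
    and gram: "gram_matrix e =
      2 *\<^sub>R vector [vector [ 2, -1,  0],
                  vector [-1,  2, -1],
                  vector [ 0, -1,  2]]"
    and M: "integral_lattice M" "M \<subseteq> span \<Lambda>\<^sub>3" "\<Lambda>\<^sub>3 \<subseteq> M"
  shows "isometric_lattices M \<Lambda>\<^sub>3 \<or>
         isometric_lattices M (adjoin \<Lambda>\<^sub>3 {(1/2) *\<^sub>R e 1}) \<or>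
         isometric_lattices M (adjoin \<Lambda>\<^sub>3 {(1/2) *\<^sub>R (e 1 + e 3)}) \<or>
         isometric_lattices M (adjoin \<Lambda>\<^sub>3 {(1/2) *\<^sub>R e 1, (1/2) *\<^sub>R e 3})"
proof -
  define a b c where "a = e 1" and "b = e 2" and "c = e 3"
  have r: "range e = {a, b, c}" by (simp add: UNIV_3 a_def b_def c_def)
  have indep: "independent {a, b, c}" and \<Lambda>: "\<Lambda>\<^sub>3 = group_closure {a, b, c}"
    using basis unfolding lattice_basis_def r by auto
  have "e i \<bullet> e j = (2 *\<^sub>R vector [vector [2, -1, 0], vector [-1, 2, -1], vector [0, -1, 2]] :: real^3^3) $ i $ j"
    for i j
    by (simp add: gram[symmetric] gram_matrix_def)
  then have G: "a3_gram a b c"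
    by (simp add: a3_gram_def a_def b_def c_def)
  obtain B where B: "M = group_closure B"
    using M(1) unfolding integral_lattice_def is_lattice_def lattice_basis_def by blast
  have int: "x \<bullet> y \<in> \<int>" if "x \<in> M" "y \<in> M" for x y
    using M(1) that unfolding integral_lattice_def by blast
  have sub: "{a, b, c} \<subseteq> M"
    using M(3) unfolding \<Lambda> by (auto intro: group_closure.base)
  have "span \<Lambda>\<^sub>3 \<subseteq> span {a, b, c}"
    unfolding \<Lambda> by (intro span_minimal group_closure_subset_span) simp
  then have span: "M \<subseteq> span {a, b, c}" using M(2) by blast
  \<comment> \<open>Nested generation is flattened so that the adjoined lattices match the
    generating sets in the lemmas above.\<close>
  have adjoin: "adjoin \<Lambda>\<^sub>3 {(1/2) *\<^sub>R e 1} = group_closure {a, b, c, (1/2) *\<^sub>R a}"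
    "adjoin \<Lambda>\<^sub>3 {(1/2) *\<^sub>R (e 1 + e 3)} = group_closure {a, b, c, (1/2) *\<^sub>R (a + c)}"
    "adjoin \<Lambda>\<^sub>3 {(1/2) *\<^sub>R e 1, (1/2) *\<^sub>R e 3} = group_closure {a, b, c, (1/2) *\<^sub>R a, (1/2) *\<^sub>R c}"
    unfolding \<Lambda> adjoin_group_closure a_def c_def by (simp_all add: insert_commute)
  show ?thesis
  proof (cases "\<exists>v\<in>{a, b, c, a + b, b + c, a + b + c}. (1/2) *\<^sub>R v \<in> M")
    case True
    then obtain v where v: "(1/2) *\<^sub>R v \<in> M" "v \<in> {a, b, c, a + b, b + c, a + b + c}" by blast
    show ?thesis
      using half_root_isometric[OF G indep B sub span int v] unfolding adjoin by blast
  next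
    case False
    then have no_half: "(1/2) *\<^sub>R v \<notin> M" if "v \<in> {a, b, c, a + b, b + c, a + b + c}" for v
      using that by blast
    have "M = group_closure {a, b, c} \<or> M = group_closure {a, b, c, (1/2) *\<^sub>R (a + c)}"
      by (rule no_half_root_overlattice[OF G B sub span int no_half])
    then show ?thesis
      unfolding adjoin using isometric_lattices_refl \<Lambda> by metis
  qed
qed

end
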